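(* Let $G$ be an amenable (discrete, not necessarily finitely generated) group. If $0\neq\alpha\in\mathbb{C}G$ and $0\neq\beta\in\ell^2(G)$ satisfy $\alpha\beta=0$, then there exists $0\neq\gamma\in\mathbb{C}G$ such that $\alpha\gamma=0$.
   Context: $\mathbb{C}G$ is the complex group algebra of $G$ (finitely supported functions $G\to\mathbb{C}$ with the convolution product), and $\ell^2(G)=\{\beta:G\to\mathbb{C} : \sum_{g\in G}|\beta(g)|^2<\infty\}$. For $\alpha=\sum_g a_g g\in\mathbb{C}G$ and $\beta\in\ell^2(G)$, the product $\alpha\beta\in\ell^2(G)$ is the convolution $(\alpha\beta)(x)=\sum_{g\in G}a_g\,\beta(g^{-1}x)$. *)

theory Defs
  imports "HOL-Algebra.Coset" "HOL-Analysis.Infinite_Sum"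
begin

text \<open>
  Amenability in von Neumann's sense: a left-invariant, finitely additive probability measure
  defined on all subsets of the (discrete) group.
\<close>

definition amenable :: "('a, 'b) monoid_scheme \<Rightarrow> bool" where
  "amenable G \<longleftrightarrow> (\<exists>\<mu> :: 'a set \<Rightarrow> real.
     (\<forall>A. A \<subseteq> carrier G \<longrightarrow> 0 \<le> \<mu> A) \<and>
     \<mu> (carrier G) = 1 \<and>
     (\<forall>A B. A \<subseteq> carrier G \<and> B \<subseteq> carrier G \<and> A \<inter> B = {} \<longrightarrow> \<mu> (A \<union> B) = \<mu> A + \<mu> B) \<and>
     (\<forall>g A. g \<in> carrier G \<and> A \<subseteq> carrier G \<longrightarrow> \<mu> (g <#\<^bsub>G\<^esub> A) = \<mu> A))"

text \<open>
  Functions on the group are total functions that vanish outside the carrier; hence the zero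
  element of both spaces below is \<open>\<lambda>_. 0\<close>, and equality of elements is equality of functions.
\<close>

definition group_algebra :: "('a, 'b) monoid_scheme \<Rightarrow> ('a \<Rightarrow> complex) set" where
  "group_algebra G = {a. (\<forall>x. x \<notin> carrier G \<longrightarrow> a x = 0) \<and> finite {x. a x \<noteq> 0}}"

definition ell2 :: "('a, 'b) monoid_scheme \<Rightarrow> ('a \<Rightarrow> complex) set" where
  "ell2 G = {b. (\<forall>x. x \<notin> carrier G \<longrightarrow> b x = 0) \<and>
                (\<lambda>x. (cmod (b x))\<^sup>2) summable_on carrier G}"

text \<open>
  The sum runs over the support of the left factor; it is finite for \<open>a \<in> group_algebra G\<close>,
  the only case in which the convolution is used.
\<close>

definition convolution ::
  "('a, 'b) monoid_scheme \<Rightarrow> ('a \<Rightarrow> complex) \<Rightarrow> ('a \<Rightarrow> complex) \<Rightarrow> 'a \<Rightarrow> complex" where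
  "convolution G a b = (\<lambda>x. if x \<in> carrier G
     then \<Sum>g | g \<in> carrier G \<and> a g \<noteq> 0. a g * b (inv\<^bsub>G\<^esub> g \<otimes>\<^bsub>G\<^esub> x) else 0)"

end

theory Submission
  imports Defs "HOL-Library.Function_Algebras" "HOL-Analysis.Convex"
begin

text \<open>
  Suppose that left multiplication by \<open>\<alpha>\<close> is injective on the group algebra, let \<open>S\<close> be the support
  of \<open>\<alpha>\<close>, let \<open>E\<close> be a finite set and \<open>F = S\<inverse>E\<close>. Cut off to \<open>F\<close>, the right translates of \<open>\<beta>\<close>
  are mapped by \<open>\<alpha>\<close> to functions supported in \<open>SF - E\<close>, so they span a space of dimension at most
  \<open>|SF - E|\<close>. On the other hand they are the columns of the matrix \<open>\<beta>(x y\<inverse> g)\<close> on \<open>F \<times> F\<close>, which has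
  trace \<open>|F| \<beta>(g)\<close> and squared Hilbert--Schmidt norm at most \<open>|F| \<parallel>\<beta>\<parallel>\<^sup>2\<close>, and hence rank at least
  \<open>|F| |\<beta>(g)|\<^sup>2 / \<parallel>\<beta>\<parallel>\<^sup>2\<close>. Thus \<open>T = S S\<inverse>\<close> enlarges every finite set by a fixed factor greater
  than \<open>1\<close>, and a power \<open>U\<close> of \<open>T\<close> doubles every finite set. By the marriage theorem two copies of
  \<open>G\<close> embed into \<open>G\<close> by maps that are piecewise left translations by elements of \<open>U\<close>, which is
  incompatible with an invariant mean.
\<close>

section \<open>Hall's marriage theorem for infinite families of finite sets\<close>

text \<open>
  Rado's argument: in a relation that is minimal with Hall's property, every index has exactly one
  partner. Finiteness of the \<open>A i\<close> makes Hall's property pass to intersections of chains; Zorn's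
  lemma is applied to the complements.
\<close>

lemma infinite_marriage:
  fixes A :: "'i \<Rightarrow> 'b set"
  assumes fin: "\<And>i. i \<in> I \<Longrightarrow> finite (A i)"
    and marriage: "\<And>J. finite J \<Longrightarrow> J \<subseteq> I \<Longrightarrow> card J \<le> card (\<Union>(A ` J))"
  shows "\<exists>f. (\<forall>i\<in>I. f i \<in> A i) \<and> inj_on f I"
proof -
  define S where "S = Sigma I A"
  define hall where "hall R \<longleftrightarrow> (\<forall>J. finite J \<and> J \<subseteq> I \<longrightarrow> card J \<le> card (R `` J))" for R :: "('i \<times> 'b) set"
  define \<D> where "\<D> = {D. D \<subseteq> S \<and> hall (S - D)}"
  have fin_image: "finite (R `` J)" if "R \<subseteq> S" "finite J" "J \<subseteq> I" for R J
  proof (rule finite_subset)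
    show "R `` J \<subseteq> \<Union>(A ` J)" using that(1) by (auto simp: S_def)
    show "finite (\<Union>(A ` J))" using that fin by blast
  qed
  have "S `` J = \<Union>(A ` J)" if "J \<subseteq> I" for J
    using that by (auto simp: S_def)
  then have "hall S"
    using marriage by (simp add: hall_def)
  then have "\<D> \<noteq> {}" by (auto simp: \<D>_def)
  moreover have "\<Union>C \<in> \<D>" if "C \<noteq> {}" "subset.chain \<D> C" for C
  proof -
    have "card J \<le> card ((S - \<Union>C) `` J)" if J: "finite J" "J \<subseteq> I" for J
    proof -
      \<comment> \<open>The pairs over \<open>J\<close> deleted by the union of the chain are finite
        in number, so a single member \<open>D\<close> of the chain deletes them all and leaves the
        same image of \<open>J\<close>.\<close>
      define N where "N = S \<inter> (J \<times> UNIV) \<inter> \<Union>C"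
      have "N \<subseteq> Sigma J A" by (auto simp: N_def S_def)
      moreover have "finite (Sigma J A)" using J fin by blast
      ultimately have "finite N" by (rule finite_subset)
      moreover have "N \<subseteq> \<Union>C" by (auto simp: N_def)
      ultimately obtain D where D: "D \<in> C" "N \<subseteq> D"
        using finite_subset_Union_chain \<open>C \<noteq> {}\<close> \<open>subset.chain \<D> C\<close> by metis
      have "(S - \<Union>C) `` J = (S - D) `` J" using D by (auto simp: N_def)
      moreover have "D \<in> \<D>" using D \<open>subset.chain \<D> C\<close> by (auto simp: subset_chain_def)
      ultimately show ?thesis using J by (simp add: \<D>_def hall_def)
    qed
    moreover have "\<Union>C \<subseteq> S"
      using \<open>subset.chain \<D> C\<close> by (auto simp: subset_chain_def \<D>_def)
    ultimately show ?thesis by (auto simp: \<D>_def hall_def)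
  qed
  ultimately obtain M where M: "M \<in> \<D>" "\<And>X. X \<in> \<D> \<Longrightarrow> M \<subseteq> X \<Longrightarrow> X = M"
    using subset_Zorn_nonempty[of \<D>] by metis
  define R where "R = S - M"
  have R: "hall R" "R \<subseteq> S" using M(1) by (auto simp: R_def \<D>_def)
  have minimal: "\<not> hall (R - {p})" if "p \<in> R" for p
  proof
    assume "hall (R - {p})"
    moreover have "S - insert p M = R - {p}" by (auto simp: R_def)
    ultimately have "insert p M \<in> \<D>"
      using M(1) that by (auto simp: \<D>_def R_def)
    with M(2)[of "insert p M"] that show False by (auto simp: R_def)
  qed
  have hallD: "card J \<le> card (R `` J)" if "finite J" "J \<subseteq> I" for J
    using R(1) that by (simp add: hall_def)
  have unique: "x = y" if xy: "(i, x) \<in> R" "(i, y) \<in> R" for i x y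
  proof (rule ccontr)
    assume "x \<noteq> y"
    \<comment> \<open>Deleting either pair breaks Hall's condition, at \<open>J1\<close> and
      \<open>J2\<close> respectively. Both sets contain \<open>i\<close>, since otherwise the
      deletion would not affect the image.\<close>
    obtain J1 where J1: "finite J1" "J1 \<subseteq> I" "card ((R - {(i, x)}) `` J1) < card J1"
      using minimal[OF xy(1)] by (auto simp: hall_def not_le)
    obtain J2 where J2: "finite J2" "J2 \<subseteq> I" "card ((R - {(i, y)}) `` J2) < card J2"
      using minimal[OF xy(2)] by (auto simp: hall_def not_le)
    define P where "P = (R - {(i, x)}) `` J1"
    define Q where "Q = (R - {(i, y)}) `` J2"
    have fPQ: "finite P" "finite Q"
      unfolding P_def Q_def using R J1 J2 by (auto intro!: fin_image)
    have "i \<in> J1"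
    proof (rule ccontr)
      assume "i \<notin> J1"
      then have "(R - {(i, x)}) `` J1 = R `` J1" by auto
      then show False using J1 hallD[of J1] by simp
    qed
    have "i \<in> J2"
    proof (rule ccontr)
      assume "i \<notin> J2"
      then have "(R - {(i, y)}) `` J2 = R `` J2" by auto
      then show False using J2 hallD[of J2] by simp
    qed
    have "card (J1 \<union> J2) \<le> card (R `` (J1 \<union> J2))"
      by (rule hallD) (use J1 J2 in auto)
    \<comment> \<open>Each of \<open>P\<close> and \<open>Q\<close> supplies the partner of
      \<open>i\<close> that the other may lack: \<open>y\<close> lies in \<open>P\<close> and
      \<open>x\<close> in \<open>Q\<close>.\<close>
    also have "\<dots> \<le> card (P \<union> Q)"
    proof (rule card_mono)
      show "R `` (J1 \<union> J2) \<subseteq> P \<union> Q"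
        using \<open>x \<noteq> y\<close> \<open>i \<in> J1\<close> \<open>i \<in> J2\<close> by (auto simp: P_def Q_def)
    qed (use fPQ in auto)
    finally have union: "card (J1 \<union> J2) \<le> card (P \<union> Q)" .
    \<comment> \<open>Without \<open>i\<close> neither deletion matters, so this image lies in both
      \<open>P\<close> and \<open>Q\<close>. Putting \<open>i\<close> back costs one, whereas the
      strict inequalities for \<open>J1\<close> and \<open>J2\<close> together lose two.\<close>
    have "card (J1 \<inter> J2 - {i}) \<le> card (R `` (J1 \<inter> J2 - {i}))"
      by (rule hallD) (use J1 J2 in auto)
    also have "\<dots> \<le> card (P \<inter> Q)"
      by (rule card_mono) (use fPQ in \<open>auto simp: P_def Q_def\<close>)
    finally have inter: "card (J1 \<inter> J2) \<le> Suc (card (P \<inter> Q))"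
      using \<open>i \<in> J1\<close> \<open>i \<in> J2\<close> J1 by (simp add: card_Diff_singleton)
    have "card P + card Q = card (P \<union> Q) + card (P \<inter> Q)"
      using fPQ by (rule card_Un_Int)
    moreover have "card J1 + card J2 = card (J1 \<union> J2) + card (J1 \<inter> J2)"
      using J1 J2 by (intro card_Un_Int) auto
    ultimately show False
      using union inter J1(3) J2(3) by (simp add: P_def Q_def)
  qed
  have ex: "\<exists>x. (i, x) \<in> R" if "i \<in> I" for i
  proof (rule ccontr)
    assume "\<nexists>x. (i, x) \<in> R"
    then have "R `` {i} = {}" by auto
    moreover have "card {i} \<le> card (R `` {i})"
      by (rule hallD) (use that in auto)
    ultimately show False by simp
  qed
  then obtain f where f: "\<And>i. i \<in> I \<Longrightarrow> (i, f i) \<in> R" by metis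
  have "inj_on f I"
  proof (rule inj_onI, rule ccontr)
    fix i j assume ij: "i \<in> I" "j \<in> I" "f i = f j" "i \<noteq> j"
    have "R `` {i, j} = {f i}"
    proof (intro equalityI subsetI)
      fix x assume "x \<in> R `` {i, j}"
      then have "(i, x) \<in> R \<or> (j, x) \<in> R" by blast
      then show "x \<in> {f i}" using f[of i] f[of j] unique ij by auto
    next
      fix x assume "x \<in> {f i}"
      then show "x \<in> R `` {i, j}" using f[of i] ij by auto
    qed
    moreover have "card {i, j} \<le> card (R `` {i, j})"
      by (rule hallD) (use ij in auto)
    ultimately show False using ij by simp
  qed
  moreover have "\<forall>i\<in>I. f i \<in> A i" using f R by (auto simp: S_def)
  ultimately show ?thesis by blast
qed

section \<open>Orthonormal expansions on a finite set and the bound of the trace by the rank\<close>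

definition inner_on :: "'a set \<Rightarrow> ('a \<Rightarrow> complex) \<Rightarrow> ('a \<Rightarrow> complex) \<Rightarrow> complex" where
  "inner_on F f g = (\<Sum>x\<in>F. f x * cnj (g x))"

lemma inner_on_commute: "inner_on F g f = cnj (inner_on F f g)"
  by (simp add: inner_on_def mult.commute)

lemma inner_on_sum_left:
  assumes "\<And>x. x \<in> F \<Longrightarrow> h x = (\<Sum>e\<in>E. c e * e x)"
  shows "inner_on F h g = (\<Sum>e\<in>E. c e * inner_on F e g)"
proof -
  have "inner_on F h g = (\<Sum>x\<in>F. \<Sum>e\<in>E. c e * (e x * cnj (g x)))"
    unfolding inner_on_def by (rule sum.cong) (simp_all add: assms sum_distrib_right mult.assoc)
  also have "\<dots> = (\<Sum>e\<in>E. c e * inner_on F e g)"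
    unfolding inner_on_def by (subst sum.swap) (simp add: sum_distrib_left)
  finally show ?thesis .
qed

lemma inner_on_self: "inner_on F f f = of_real (\<Sum>x\<in>F. (cmod (f x))\<^sup>2)"
  by (simp only: inner_on_def of_real_sum complex_norm_square)

text \<open>An element of \<open>H\<close> that adds nothing new on \<open>F\<close> is skipped,
  hence only an inequality of cardinalities. The functions are total but \<open>inner_on F\<close>
  sees only their values on \<open>F\<close>, so the expansion is claimed on \<open>F\<close>
  alone.\<close>

lemma gram_schmidt:
  assumes "finite F" "finite H"
  shows "\<exists>E. finite E \<and> card E \<le> card H
    \<and> (\<forall>e\<in>E. \<forall>e'\<in>E. inner_on F e e' = (if e = e' then 1 else 0))
    \<and> (\<forall>h\<in>H. \<forall>x\<in>F. h x = (\<Sum>e\<in>E. inner_on F h e * e x))"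
  using assms(2)
proof induction
  case empty
  show ?case by (intro exI[of _ "{}"]) auto
next
  case (insert h H)
  then obtain E where E: "finite E" "card E \<le> card H"
    and orth': "\<forall>e\<in>E. \<forall>e'\<in>E. inner_on F e e' = (if e = e' then 1 else 0)"
    and expand': "\<forall>h\<in>H. \<forall>x\<in>F. h x = (\<Sum>e\<in>E. inner_on F h e * e x)"
    by blast
  note orth = orth'[rule_format] and expand = expand'[rule_format]
  \<comment> \<open>The component of \<open>h\<close> orthogonal to \<open>E\<close> on
    \<open>F\<close>. Unless it vanishes on \<open>F\<close>, its normalisation \<open>v\<close>
    joins the family.\<close>
  define u where "u = (\<lambda>x. h x - (\<Sum>e\<in>E. inner_on F h e * e x))"
  have ue: "inner_on F u e = 0" if "e \<in> E" for e
  proof -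
    have "inner_on F u e = inner_on F h e - inner_on F (\<lambda>x. \<Sum>e\<in>E. inner_on F h e * e x) e"
      by (simp add: u_def inner_on_def sum_subtractf algebra_simps)
    also have "inner_on F (\<lambda>x. \<Sum>e\<in>E. inner_on F h e * e x) e = (\<Sum>e'\<in>E. inner_on F h e' * inner_on F e' e)"
      by (rule inner_on_sum_left) simp
    also have "\<dots> = (\<Sum>e'\<in>E. if e' = e then inner_on F h e else 0)"
      by (rule sum.cong) (auto simp: orth that)
    also have "\<dots> = inner_on F h e" using E that by simp
    finally show ?thesis by simp
  qed
  show ?case
  proof (cases "\<forall>x\<in>F. u x = 0")
    case True
    then show ?thesis using insert E orth expand by (intro exI[of _ E]) (auto simp: u_def)
  next
    case False
    define n where "n = sqrt (\<Sum>x\<in>F. (cmod (u x))\<^sup>2)"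
    have "(\<Sum>x\<in>F. (cmod (u x))\<^sup>2) > 0"
      using False \<open>finite F\<close> by (auto intro!: sum_pos2)
    then have n: "n > 0" "n\<^sup>2 = (\<Sum>x\<in>F. (cmod (u x))\<^sup>2)" by (auto simp: n_def)
    define v where "v = (\<lambda>x. u x / of_real n)"
    have vl: "inner_on F v g = inner_on F u g / of_real n" for g
      by (simp add: v_def inner_on_def sum_divide_distrib)
    have vr: "inner_on F g v = inner_on F g u / of_real n" for g
      by (simp add: v_def inner_on_def sum_divide_distrib)
    have uu: "inner_on F u u = of_real (n\<^sup>2)" by (simp only: inner_on_self n)
    have vv: "inner_on F v v = 1"
      using n(1) by (simp add: vl vr uu power2_eq_square)
    have ve: "inner_on F v e = 0" "inner_on F e v = 0" if "e \<in> E" for e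
      using ue[OF that] vl[of e] inner_on_commute[of F e v] by auto
    have "v \<notin> E" using ve vv by fastforce
    have "g x = (\<Sum>e\<in>insert v E. inner_on F g e * e x)" if "g \<in> insert h H" "x \<in> F" for g x
    proof (cases "g = h")
      case True
      \<comment> \<open>The coefficient at \<open>v\<close> is \<open>n\<close> because
        \<open>u\<close> is \<open>n\<close> times \<open>v\<close>; pairing this expansion with
        \<open>v\<close> then identifies \<open>n\<close> with
        \<open>inner_on F h v\<close>.\<close>
      have "h y = (\<Sum>e\<in>insert v E. (if e = v then of_real n else inner_on F h e) * e y)" for y
      proof -
        have "(\<Sum>e\<in>E. (if e = v then of_real n else inner_on F h e) * e y) = (\<Sum>e\<in>E. inner_on F h e * e y)"
          by (rule sum.cong) (use \<open>v \<notin> E\<close> in auto)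
        then show ?thesis using E n \<open>v \<notin> E\<close> by (simp add: v_def u_def)
      qed
      then have "inner_on F h v = (\<Sum>e\<in>insert v E. (if e = v then of_real n else inner_on F h e) * inner_on F e v)"
        by (rule inner_on_sum_left)
      also have "\<dots> = of_real n"
        using E \<open>v \<notin> E\<close> vv ve by (simp add: sum.neutral)
      finally show ?thesis
        using E n \<open>v \<notin> E\<close> True by (simp add: v_def u_def)
    next
      case False
      then have "g \<in> H" using that by simp
      have "inner_on F g v = (\<Sum>e\<in>E. inner_on F g e * inner_on F e v)"
        by (rule inner_on_sum_left) (rule expand[OF \<open>g \<in> H\<close>])
      also have "\<dots> = 0" using ve by simp
      finally show ?thesis using expand[OF \<open>g \<in> H\<close> that(2)] E \<open>v \<notin> E\<close> by simp
    qed
    moreover have "inner_on F e e' = (if e = e' then 1 else 0)"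
      if "e \<in> insert v E" "e' \<in> insert v E" for e e'
      using that orth vv ve \<open>v \<notin> E\<close> by auto
    moreover have "card (insert v E) \<le> card (insert h H)"
      using E insert \<open>v \<notin> E\<close> by simp
    ultimately show ?thesis using E by (intro exI[of _ "insert v E"]) auto
  qed
qed

text \<open>This is the inequality \<open>|tr M|\<^sup>2 \<le> rank M \<cdot> \<parallel>M\<parallel>\<^sup>2\<close> for the Hilbert--Schmidt norm.\<close>

lemma trace_le_card_orthonormal:
  assumes "finite F" "finite E"
    and orth: "\<And>e e'. e \<in> E \<Longrightarrow> e' \<in> E \<Longrightarrow> inner_on F e e' = (if e = e' then 1 else 0)"
    and expand: "\<And>y x. y \<in> F \<Longrightarrow> x \<in> F \<Longrightarrow> M y x = (\<Sum>e\<in>E. inner_on F (M y) e * e x)"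
  shows "(cmod (\<Sum>y\<in>F. M y y))\<^sup>2 \<le> card E * (\<Sum>y\<in>F. \<Sum>x\<in>F. (cmod (M y x))\<^sup>2)"
proof -
  define c where "c y e = inner_on F (M y) e" for y e
  have parseval: "(\<Sum>e\<in>E. (cmod (c y e))\<^sup>2) = (\<Sum>x\<in>F. (cmod (M y x))\<^sup>2)" if "y \<in> F" for y
  proof -
    have "inner_on F (M y) (M y) = (\<Sum>e\<in>E. c y e * inner_on F e (M y))"
      unfolding c_def by (rule inner_on_sum_left) (rule expand[OF that])
    also have "\<dots> = (\<Sum>e\<in>E. c y e * cnj (c y e))"
      by (simp add: c_def inner_on_commute[of F _ "M y"])
    also have "\<dots> = of_real (\<Sum>e\<in>E. (cmod (c y e))\<^sup>2)"
      by (simp only: of_real_sum complex_norm_square)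
    finally show ?thesis by (simp only: inner_on_self of_real_eq_iff)
  qed
  have unit: "(\<Sum>y\<in>F. (cmod (e y))\<^sup>2) = 1" if "e \<in> E" for e
  proof -
    have "complex_of_real (\<Sum>y\<in>F. (cmod (e y))\<^sup>2) = 1"
      using orth[OF that that] by (simp only: inner_on_self) simp
    then show ?thesis by (simp only: of_real_eq_1_iff)
  qed
  have "cmod (\<Sum>y\<in>F. M y y) = cmod (\<Sum>y\<in>F. \<Sum>e\<in>E. c y e * e y)"
    unfolding c_def using expand by (metis (mono_tags, lifting) sum.cong)
  also have "\<dots> \<le> (\<Sum>y\<in>F. \<Sum>e\<in>E. cmod (c y e) * cmod (e y))"
    by (intro order.trans[OF norm_sum] sum_mono) (simp add: norm_mult)
  \<comment> \<open>Indexing by pairs lets one application of Cauchy-Schwarz separate the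
    coefficients, whose squares sum to the squared Hilbert-Schmidt norm, from the basis vectors,
    whose squares sum to \<open>card E\<close>.\<close>
  also have "\<dots> = (\<Sum>p\<in>F \<times> E. cmod (c (fst p) (snd p)) * cmod (snd p (fst p)))"
    by (simp add: sum.cartesian_product case_prod_beta)
  finally have "(cmod (\<Sum>y\<in>F. M y y))\<^sup>2
      \<le> (\<Sum>p\<in>F \<times> E. cmod (c (fst p) (snd p)) * cmod (snd p (fst p)))\<^sup>2"
    by (simp add: power_mono)
  also have "\<dots> \<le> (\<Sum>p\<in>F \<times> E. (cmod (c (fst p) (snd p)))\<^sup>2) * (\<Sum>p\<in>F \<times> E. (cmod (snd p (fst p)))\<^sup>2)"
    by (rule Cauchy_Schwarz_ineq_sum)
  also have "(\<Sum>p\<in>F \<times> E. (cmod (c (fst p) (snd p)))\<^sup>2) = (\<Sum>y\<in>F. \<Sum>x\<in>F. (cmod (M y x))\<^sup>2)"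
    by (simp add: sum.cartesian_product' parseval)
  also have "(\<Sum>p\<in>F \<times> E. (cmod (snd p (fst p)))\<^sup>2) = (\<Sum>e\<in>E. \<Sum>y\<in>F. (cmod (e y))\<^sup>2)"
    by (subst sum.swap) (simp add: sum.cartesian_product')
  also have "\<dots> = card E" by (simp add: unit)
  finally show ?thesis by (simp add: mult.commute)
qed

interpretation cfun: vector_space "\<lambda>(c::complex) (f::'a \<Rightarrow> complex) x. c * f x"
  by standard (auto simp: algebra_simps)

text \<open>An orthonormal family obtained from \<open>H\<close> expands each element of
  \<open>H\<close> on \<open>F\<close>. This property is stable under linear combinations, so it
  reaches every row \<open>M y\<close>.\<close>

lemma trace_le_card_spanning:
  fixes M :: "'a \<Rightarrow> 'a \<Rightarrow> complex"
  assumes "finite F" "finite H" and span: "\<And>y. y \<in> F \<Longrightarrow> M y \<in> cfun.span H"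
  shows "(cmod (\<Sum>y\<in>F. M y y))\<^sup>2 \<le> card H * (\<Sum>y\<in>F. \<Sum>x\<in>F. (cmod (M y x))\<^sup>2)"
proof -
  obtain E where E: "finite E" "card E \<le> card H"
    and orth: "\<forall>e\<in>E. \<forall>e'\<in>E. inner_on F e e' = (if e = e' then 1 else 0)"
    and expand: "\<forall>h\<in>H. \<forall>x\<in>F. h x = (\<Sum>e\<in>E. inner_on F h e * e x)"
    using gram_schmidt[OF assms(1,2)] by blast
  have "\<forall>x\<in>F. f x = (\<Sum>e\<in>E. inner_on F f e * e x)" if "f \<in> cfun.span H" for f
    using that
  proof (induction rule: cfun.span_induct_alt)
    case base
    then show ?case by (simp add: inner_on_def)
  next
    case (step c f g)
    define k where "k = (\<lambda>x. c * f x) + g"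
    have "inner_on F k e = c * inner_on F f e + inner_on F g e" for e
      by (simp add: k_def inner_on_def sum_distrib_left sum.distrib algebra_simps)
    moreover have "k x = (\<Sum>e\<in>E. (c * inner_on F f e + inner_on F g e) * e x)" if "x \<in> F" for x
    proof -
      have "c * f x + g x = c * (\<Sum>e\<in>E. inner_on F f e * e x) + (\<Sum>e\<in>E. inner_on F g e * e x)"
        using expand step that by metis
      then show ?thesis
        by (simp add: k_def distrib_right sum.distrib sum_distrib_left mult.assoc)
    qed
    ultimately have "\<forall>x\<in>F. k x = (\<Sum>e\<in>E. inner_on F k e * e x)" by simp
    then show ?case by (simp only: k_def)
  qed
  then have "(cmod (\<Sum>y\<in>F. M y y))\<^sup>2 \<le> card E * (\<Sum>y\<in>F. \<Sum>x\<in>F. (cmod (M y x))\<^sup>2)"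
    using assms E orth span by (intro trace_le_card_orthonormal) auto
  also have "\<dots> \<le> card H * (\<Sum>y\<in>F. \<Sum>x\<in>F. (cmod (M y x))\<^sup>2)"
    using E by (intro mult_right_mono sum_nonneg) auto
  finally show ?thesis .
qed

section \<open>Finite product sets, and convolution by a fixed element as a linear map\<close>

lemma (in group) set_mult_finite:
  assumes "finite H" "finite K"
  shows "finite (H <#> K)"
  using assms by (auto simp: set_mult_def)

lemma (in group) card_le_set_mult:
  assumes "finite H" "finite K" "H \<subseteq> carrier G" "K \<subseteq> carrier G" "H \<noteq> {}"
  shows "card K \<le> card (H <#> K)"
proof -
  obtain h where h: "h \<in> H" using assms by blast
  have "inj_on (\<lambda>k. h \<otimes> k) K" using h assms by (intro inj_onI) (metis Units_eq Units_l_cancel subsetD)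
  moreover have "(\<lambda>k. h \<otimes> k) ` K \<subseteq> H <#> K" using h by (auto simp: set_mult_def)
  ultimately show ?thesis using assms set_mult_finite by (metis card_inj_on_le)
qed

lemma (in group) convolution_linear:
  "Vector_Spaces.linear (\<lambda>(c::complex) f x. c * f x) (\<lambda>(c::complex) f x. c * f x) (convolution G a)"
  unfolding module_hom_iff_linear[symmetric]
  by unfold_locales
    (auto simp: convolution_def fun_eq_iff sum.distrib sum_distrib_left algebra_simps)

lemma group_algebra_subspace: "cfun.subspace (group_algebra G)"
proof (rule cfun.subspaceI)
  show "f + g \<in> group_algebra G" if "f \<in> group_algebra G" "g \<in> group_algebra G" for f g
  proof -
    have "{x. (f + g) x \<noteq> 0} \<subseteq> {x. f x \<noteq> 0} \<union> {x. g x \<noteq> 0}" by auto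
    then show ?thesis using that by (auto simp: group_algebra_def intro: finite_subset)
  qed
qed (auto simp: group_algebra_def)

lemma in_span_indicators:
  assumes "finite B" "\<And>x. x \<notin> B \<Longrightarrow> f x = (0::complex)"
  shows "f \<in> cfun.span ((\<lambda>b x. if x = b then 1 else 0) ` B)"
proof -
  have "f = (\<Sum>b\<in>B. (\<lambda>x. f b * (if x = b then 1 else 0)))"
  proof
    fix x
    have "(\<Sum>b\<in>A. (\<lambda>x. f b * (if x = b then 1 else 0))) x = (\<Sum>b\<in>A. f b * (if x = b then 1 else 0))"
      if "finite A" for A
      using that by induction auto
    then show "f x = (\<Sum>b\<in>B. (\<lambda>x. f b * (if x = b then 1 else 0))) x"
      using assms by (auto simp: if_distrib[of "(*) _"] cong: if_cong)
  qed
  also have "\<dots> \<in> cfun.span ((\<lambda>b x. if x = b then 1 else 0) ` B)"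
    by (intro cfun.span_sum cfun.span_scale cfun.span_base imageI)
  finally show ?thesis .
qed

text \<open>A maximal independent subfamily of the rows \<open>M y\<close> stays independent under
  convolution by \<alpha>, and its image lies in the span of the point indicators of
  \<open>B\<close>. So the rank is at most \<open>card B\<close>, and the trace inequality
  applies.\<close>

lemma (in group) card_supporting_set_ge:
  assumes inj: "\<And>\<gamma>. \<gamma> \<in> group_algebra G \<Longrightarrow> convolution G \<alpha> \<gamma> = (\<lambda>_. 0) \<Longrightarrow> \<gamma> = (\<lambda>_. 0)"
    and "finite F" "finite B"
    and M: "\<And>y. y \<in> F \<Longrightarrow> M y \<in> group_algebra G"
    and supp: "\<And>y x. y \<in> F \<Longrightarrow> x \<notin> B \<Longrightarrow> convolution G \<alpha> (M y) x = 0"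
  shows "(cmod (\<Sum>y\<in>F. M y y))\<^sup>2 \<le> card B * (\<Sum>y\<in>F. \<Sum>x\<in>F. (cmod (M y x))\<^sup>2)"
proof -
  interpret conv: Vector_Spaces.linear "\<lambda>(c::complex) (f::'a \<Rightarrow> complex) x. c * f x" "\<lambda>(c::complex) (f::'a \<Rightarrow> complex) x. c * f x"
    "convolution G \<alpha>"
    by (rule convolution_linear)
  obtain H where H: "H \<subseteq> M ` F" "cfun.independent H" "M ` F \<subseteq> cfun.span H"
    by (rule cfun.maximal_independent_subset)
  \<comment> \<open>Injectivity is assumed on the group algebra only, so the span must be kept
    inside it.\<close>
  have "cfun.span H \<subseteq> group_algebra G"
    using H M by (intro cfun.span_minimal group_algebra_subspace) auto
  then have inj_span: "inj_on (convolution G \<alpha>) (cfun.span H)"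
    using inj by (subst conv.inj_on_iff_eq_0) (auto simp: zero_fun_def cfun.subspace_span)
  have "finite H" using H \<open>finite F\<close> finite_subset by blast
  define D where "D = (\<lambda>b x. if x = b then 1 else 0 :: complex) ` B"
  have "cfun.independent (convolution G \<alpha> ` H)"
    using H inj_span by (intro conv.independent_injective_image)
  moreover have "convolution G \<alpha> ` H \<subseteq> cfun.span D"
    unfolding D_def using H supp \<open>finite B\<close> by (auto intro!: in_span_indicators)
  moreover have "finite D" using \<open>finite B\<close> by (simp add: D_def)
  ultimately have "card (convolution G \<alpha> ` H) \<le> card D"
    using cfun.independent_span_bound by blast
  also have "\<dots> \<le> card B" unfolding D_def using \<open>finite B\<close> by (rule card_image_le)
  also have "card (convolution G \<alpha> ` H) = card H"
    using inj_span cfun.span_superset inj_on_subset card_image by metis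
  finally have "card H \<le> card B" .
  have "(cmod (\<Sum>y\<in>F. M y y))\<^sup>2 \<le> card H * (\<Sum>y\<in>F. \<Sum>x\<in>F. (cmod (M y x))\<^sup>2)"
    using \<open>finite F\<close> \<open>finite H\<close> H by (intro trace_le_card_spanning) auto
  also have "\<dots> \<le> card B * (\<Sum>y\<in>F. \<Sum>x\<in>F. (cmod (M y x))\<^sup>2)"
    using \<open>card H \<le> card B\<close> by (intro mult_right_mono sum_nonneg) auto
  finally show ?thesis .
qed

section \<open>Expansion of finite subsets of the group\<close>

text \<open>With \<open>F = S' <#> E\<close>, the set \<open>S <#> F\<close> contains
  \<open>E\<close> and, by the rank inequality, at least \<tau> times \<open>card F\<close> further
  points; moreover \<open>card E \<le> card F\<close>. Here \<tau> is the share of one point in the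
  squared norm of \<beta>, so it does not depend on \<open>E\<close>.\<close>

lemma (in group) uniform_expansion:
  assumes \<alpha>: "\<alpha> \<in> group_algebra G" "\<alpha> \<noteq> (\<lambda>_. 0)"
    and \<beta>: "\<beta> \<in> ell2 G" "\<beta> \<noteq> (\<lambda>_. 0)" "convolution G \<alpha> \<beta> = (\<lambda>_. 0)"
    and inj: "\<And>\<gamma>. \<gamma> \<in> group_algebra G \<Longrightarrow> convolution G \<alpha> \<gamma> = (\<lambda>_. 0) \<Longrightarrow> \<gamma> = (\<lambda>_. 0)"
  obtains \<tau> T where "\<tau> > 0" "finite T" "T \<subseteq> carrier G"
    "\<And>E. finite E \<Longrightarrow> E \<subseteq> carrier G \<Longrightarrow> (1 + \<tau>) * real (card E) \<le> real (card (T <#> E))"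
proof -
  define S where "S = {g \<in> carrier G. \<alpha> g \<noteq> 0}"
  have S: "finite S" "S \<subseteq> carrier G" "S \<noteq> {}"
    using \<alpha> by (auto simp: S_def group_algebra_def)
  define S' where "S' = (\<lambda>s. inv s) ` S"
  have S': "finite S'" "S' \<subseteq> carrier G" "S' \<noteq> {}" using S by (auto simp: S'_def)
  obtain g where g: "g \<in> carrier G" "\<beta> g \<noteq> 0" using \<beta> by (auto simp: ell2_def)
  define b where "b = (\<Sum>\<^sub>\<infinity>x\<in>carrier G. (cmod (\<beta> x))\<^sup>2)"
  have sum_le: "(\<Sum>x\<in>A. (cmod (\<beta> x))\<^sup>2) \<le> b" if "finite A" "A \<subseteq> carrier G" for A
    unfolding b_def using \<beta>(1) that by (intro finite_sum_le_infsum) (auto simp: ell2_def)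
  define c where "c = (cmod (\<beta> g))\<^sup>2"
  have "c > 0" using g by (simp add: c_def)
  have "c \<le> b" using sum_le[of "{g}"] g by (simp add: c_def)
  with \<open>c > 0\<close> have "b > 0" by linarith
  have conv: "(\<Sum>s\<in>S. \<alpha> s * \<beta> (inv s \<otimes> x)) = 0" if "x \<in> carrier G" for x
    using fun_cong[OF \<beta>(3), of x] that by (simp add: convolution_def S_def)
  have boundary: "c / b * card F \<le> card ((S <#> F) - E)"
    if E: "finite E" "E \<subseteq> carrier G" and F_def: "F = S' <#> E" for E F
  proof -
    have F: "finite F" "F \<subseteq> carrier G"
      using E S' set_mult_finite set_mult_closed by (auto simp: F_def)
    \<comment> \<open>Right translates of \<beta>, cut off to \<open>F\<close>. The shift by
      \<open>inv y \<otimes> g\<close> puts the value \<open>\<beta> g\<close> in every diagonal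
      entry.\<close>
    define M where "M y x = (if x \<in> F then \<beta> (x \<otimes> (inv y \<otimes> g)) else 0)" for y x
    have "(cmod (\<Sum>y\<in>F. M y y))\<^sup>2 \<le> card ((S <#> F) - E) * (\<Sum>y\<in>F. \<Sum>x\<in>F. (cmod (M y x))\<^sup>2)"
    proof (rule card_supporting_set_ge[OF inj])
      show "M y \<in> group_algebra G" for y
        using F by (auto simp: group_algebra_def M_def)
      show "finite ((S <#> F) - E)" using S F set_mult_finite by simp
      show "convolution G \<alpha> (M y) x = 0" if "y \<in> F" "x \<notin> (S <#> F) - E" for y x
      proof (cases "x \<in> E")
        case True
        \<comment> \<open>For \<open>x\<close> in \<open>E\<close> the cut-off is not felt, so the
          value is that of the convolution of \<alpha> and \<beta> at a translated point, which is
          zero.\<close>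
        have "inv s \<otimes> x \<in> F" if "s \<in> S" for s
          using True that by (auto simp: F_def S'_def set_mult_def)
        moreover have carrier: "x \<in> carrier G" "y \<in> carrier G" using True E F that by auto
        ultimately have "convolution G \<alpha> (M y) x = (\<Sum>s\<in>S. \<alpha> s * \<beta> (inv s \<otimes> (x \<otimes> (inv y \<otimes> g))))"
          using g by (auto simp: convolution_def S_def M_def m_assoc intro!: sum.cong)
        also have "\<dots> = 0" using carrier g by (intro conv) simp
        finally show ?thesis .
      next
        case False
        \<comment> \<open>Here \<open>x\<close> lies outside \<open>S <#> F\<close>: on the carrier
          every term is cut off, and elsewhere the convolution is zero by definition.\<close>
        have "inv s \<otimes> x \<notin> F" if "s \<in> S" "x \<in> carrier G" for s
        proof
          assume "inv s \<otimes> x \<in> F"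
          then have "s \<otimes> (inv s \<otimes> x) \<in> S <#> F" using that by (auto simp: set_mult_def)
          moreover have "s \<otimes> (inv s \<otimes> x) = x"
            using that S by (simp add: m_assoc[symmetric] subset_iff)
          ultimately show False using False \<open>x \<notin> (S <#> F) - E\<close> by simp
        qed
        then show ?thesis by (auto simp: convolution_def S_def M_def intro!: sum.neutral)
      qed
    qed (use F in auto)
    moreover have "(\<Sum>y\<in>F. M y y) = of_nat (card F) * \<beta> g"
    proof -
      have "M y y = \<beta> g" if "y \<in> F" for y
        using that F g by (simp add: M_def m_assoc[symmetric] subset_iff)
      then show ?thesis by simp
    qed
    moreover have "(\<Sum>y\<in>F. \<Sum>x\<in>F. (cmod (M y x))\<^sup>2) \<le> card F * b"
    proof (rule sum_bounded_above)
      fix y assume "y \<in> F"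
      \<comment> \<open>Right translation is injective, so the squares in a row are distinct terms
        of the sum \<open>b\<close>.\<close>
      have "inj_on (\<lambda>x. x \<otimes> (inv y \<otimes> g)) F"
        using F g \<open>y \<in> F\<close> by (intro inj_onI) (simp add: subset_iff)
      then have "(\<Sum>x\<in>F. (cmod (M y x))\<^sup>2) = (\<Sum>z\<in>(\<lambda>x. x \<otimes> (inv y \<otimes> g)) ` F. (cmod (\<beta> z))\<^sup>2)"
        by (simp add: sum.reindex M_def)
      also have "\<dots> \<le> b" using F g \<open>y \<in> F\<close> by (intro sum_le) auto
      finally show "(\<Sum>x\<in>F. (cmod (M y x))\<^sup>2) \<le> b" .
    qed
    ultimately have "(cmod (of_nat (card F) * \<beta> g))\<^sup>2 \<le> card ((S <#> F) - E) * (card F * b)"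
      by (metis (no_types, lifting) mult_left_mono of_nat_0_le_iff order_trans)
    then have "(real (card F))\<^sup>2 * c \<le> card ((S <#> F) - E) * (card F * b)"
      by (simp add: norm_mult power_mult_distrib c_def)
    then show ?thesis
      using \<open>b > 0\<close> by (cases "card F = 0") (simp_all add: power2_eq_square field_simps)
  qed
  have expand: "(1 + c / b) * real (card E) \<le> real (card (S <#> S' <#> E))"
    if E: "finite E" "E \<subseteq> carrier G" for E
  proof -
    define F where "F = S' <#> E"
    have F: "finite F" "F \<subseteq> carrier G"
      using E S' set_mult_finite set_mult_closed by (auto simp: F_def)
    have "E \<subseteq> S <#> F"
    proof
      fix x assume "x \<in> E"
      obtain s where s: "s \<in> S" using S by blast
      then have "s \<otimes> (inv s \<otimes> x) \<in> S <#> F"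
        using \<open>x \<in> E\<close> by (auto simp: set_mult_def F_def S'_def)
      moreover have "s \<otimes> (inv s \<otimes> x) = x"
        using s S E \<open>x \<in> E\<close> by (simp add: m_assoc[symmetric] subset_iff)
      ultimately show "x \<in> S <#> F" by simp
    qed
    then have "card (S <#> F) = card E + card ((S <#> F) - E)"
      using S F E set_mult_finite by (metis card_Diff_subset card_mono le_add_diff_inverse)
    moreover have "c / b * card F \<le> card ((S <#> F) - E)" using boundary E F_def by blast
    moreover have "card E \<le> card F" unfolding F_def using E S' by (intro card_le_set_mult)
    then have "c / b * card E \<le> c / b * card F"
      using \<open>b > 0\<close> \<open>c > 0\<close> by (intro mult_left_mono) auto
    moreover have "S <#> S' <#> E = S <#> F"
      using set_mult_assoc[OF S(2) S'(2) E(2)] by (simp add: F_def)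
    ultimately show ?thesis by (simp add: distrib_right)
  qed
  show thesis
  proof (rule that)
    show "c / b > 0" using \<open>b > 0\<close> \<open>c > 0\<close> by simp
    show "finite (S <#> S')" "S <#> S' \<subseteq> carrier G"
      using S S' set_mult_finite set_mult_closed by auto
  qed (rule expand)
qed

text \<open>\<open>U\<close> is a power of \<open>T\<close>: expansion factors multiply along
  iterated products, and \<open>(1 + \<tau>) ^ n\<close> eventually exceeds 2.\<close>

lemma (in group) expansion_doubling:
  assumes "\<tau> > 0" and T: "finite T" "T \<subseteq> carrier G"
    and expand: "\<And>E. finite E \<Longrightarrow> E \<subseteq> carrier G \<Longrightarrow> (1 + \<tau>) * real (card E) \<le> real (card (T <#> E))"
  obtains U where "finite U" "U \<subseteq> carrier G"
    "\<And>E. finite E \<Longrightarrow> E \<subseteq> carrier G \<Longrightarrow> 2 * card E \<le> card (U <#> E)"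
proof -
  have power: "\<exists>U. finite U \<and> U \<subseteq> carrier G \<and>
    (\<forall>E. finite E \<and> E \<subseteq> carrier G \<longrightarrow> (1 + \<tau>) ^ n * real (card E) \<le> real (card (U <#> E)))" for n
  proof (induction n)
    case 0
    have "{\<one>} <#> E = E" if "E \<subseteq> carrier G" for E
      using that by (auto simp: set_mult_def subset_iff)
    then show ?case by (intro exI[of _ "{\<one>}"]) auto
  next
    case (Suc n)
    then obtain U where U: "finite U" "U \<subseteq> carrier G"
      and IH: "\<forall>E. finite E \<and> E \<subseteq> carrier G \<longrightarrow> (1 + \<tau>) ^ n * real (card E) \<le> real (card (U <#> E))"
      by (elim exE conjE) (rule that)
    have "(1 + \<tau>) ^ Suc n * real (card E) \<le> real (card (T <#> U <#> E))"
      if E: "finite E" "E \<subseteq> carrier G" for E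
    proof -
      have "(1 + \<tau>) ^ Suc n * real (card E) \<le> (1 + \<tau>) * real (card (U <#> E))"
        using IH E \<open>\<tau> > 0\<close> by (simp add: mult.assoc)
      also have "\<dots> \<le> real (card (T <#> (U <#> E)))"
        using E U by (intro expand set_mult_finite set_mult_closed)
      also have "T <#> (U <#> E) = T <#> U <#> E"
        using set_mult_assoc[OF T(2) U(2) E(2)] by simp
      finally show ?thesis .
    qed
    moreover have "finite (T <#> U)" "T <#> U \<subseteq> carrier G"
      using T U set_mult_finite set_mult_closed by auto
    ultimately show ?case by blast
  qed
  obtain n where "2 < (1 + \<tau>) ^ n"
    using \<open>\<tau> > 0\<close> real_arch_pow[of "1 + \<tau>" 2] by auto
  obtain U where U: "finite U" "U \<subseteq> carrier G"
      and *: "\<forall>E. finite E \<and> E \<subseteq> carrier G \<longrightarrow> (1 + \<tau>) ^ n * real (card E) \<le> real (card (U <#> E))"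
    using power[of n] by (elim exE conjE) (rule that)
  have "2 * card E \<le> card (U <#> E)" if E: "finite E" "E \<subseteq> carrier G" for E
  proof -
    have "2 * real (card E) \<le> (1 + \<tau>) ^ n * real (card E)"
      using \<open>2 < (1 + \<tau>) ^ n\<close> by (intro mult_right_mono) auto
    also have "\<dots> \<le> real (card (U <#> E))" using * E by blast
    finally show ?thesis by linarith
  qed
  with U show thesis by (rule that)
qed

section \<open>Incompatibility of doubling with an invariant mean\<close>

text \<open>The marriage theorem injects two copies of the group, indexed by \<open>bool\<close>,
  into the group by left translations on finitely many pieces. The pieces have total measure 2, but
  their translates are disjoint and have total measure at most 1.\<close>

lemma (in group) amenable_not_doubling:
  assumes "amenable G" and U: "finite U" "U \<subseteq> carrier G"
    and doubling: "\<And>E. finite E \<Longrightarrow> E \<subseteq> carrier G \<Longrightarrow> 2 * card E \<le> card (U <#> E)"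
  shows False
proof -
  obtain \<mu> :: "'a set \<Rightarrow> real" where nonneg: "\<forall>A. A \<subseteq> carrier G \<longrightarrow> 0 \<le> \<mu> A"
    and total: "\<mu> (carrier G) = 1"
    and additive: "\<forall>A B. A \<subseteq> carrier G \<and> B \<subseteq> carrier G \<and> A \<inter> B = {} \<longrightarrow> \<mu> (A \<union> B) = \<mu> A + \<mu> B"
    and invariant: "\<forall>g A. g \<in> carrier G \<and> A \<subseteq> carrier G \<longrightarrow> \<mu> (g <#\<^bsub>G\<^esub> A) = \<mu> A"
    using \<open>amenable G\<close> unfolding amenable_def by (elim exE conjE) (rule that)
  have add: "\<mu> (A \<union> B) = \<mu> A + \<mu> B" if "A \<subseteq> carrier G" "B \<subseteq> carrier G" "A \<inter> B = {}" for A B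
    using additive that by simp
  have "\<mu> {} = 0" using add[of "{}" "{}"] by simp
  have mu_UN: "\<mu> (\<Union>i\<in>I. A i) = (\<Sum>i\<in>I. \<mu> (A i))"
    if "finite I" "\<And>i. i \<in> I \<Longrightarrow> A i \<subseteq> carrier G" "disjoint_family_on A I" for I :: "'i set" and A
    using that
  proof (induction I)
    case (insert i I)
    have "A i \<inter> (\<Union>i\<in>I. A i) = {}"
      using insert by (auto simp: disjoint_family_on_def)
    then have "\<mu> (A i \<union> (\<Union>i\<in>I. A i)) = \<mu> (A i) + \<mu> (\<Union>i\<in>I. A i)"
      using insert.prems by (intro add) auto
    moreover have "\<mu> (\<Union>i\<in>I. A i) = (\<Sum>i\<in>I. \<mu> (A i))"
      using insert by (auto simp: disjoint_family_on_def)
    ultimately show ?case using insert.hyps by simp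
  qed (simp add: \<open>\<mu> {} = 0\<close>)
  have "\<exists>f. (\<forall>p\<in>carrier G \<times> (UNIV::bool set). f p \<in> U <#> {fst p}) \<and> inj_on f (carrier G \<times> (UNIV::bool set))"
  proof (rule infinite_marriage)
    show "finite (U <#> {fst p})" for p :: "'a \<times> bool" using U set_mult_finite by simp
    show "card J \<le> card (\<Union>p\<in>J. U <#> {fst p})"
      if J: "finite J" "J \<subseteq> carrier G \<times> (UNIV::bool set)" for J
    proof -
      \<comment> \<open>\<open>J\<close> has at most two elements over each point of its projection,
        which is exactly the factor that doubling provides.\<close>
      have "card J \<le> card (fst ` J \<times> (UNIV::bool set))"
        using J by (intro card_mono) force+
      also have "\<dots> = 2 * card (fst ` J)" by (simp add: card_cartesian_product)
      also have "\<dots> \<le> card (U <#> fst ` J)" using J by (intro doubling) auto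
      also have "U <#> fst ` J = (\<Union>p\<in>J. U <#> {fst p})" by (auto simp: set_mult_def)
      finally show ?thesis .
    qed
  qed
  then obtain f where f: "\<And>x i. x \<in> carrier G \<Longrightarrow> f (x, i) \<in> U <#> {x}"
    and inj: "inj_on f (carrier G \<times> (UNIV::bool set))" by fastforce
  \<comment> \<open>The piece of copy \<open>i\<close> on which \<open>f\<close> is left translation
    by \<open>t\<close>. Right cancellation makes the pieces of one copy disjoint.\<close>
  define A where "A i t = {x \<in> carrier G. f (x, i) = t \<otimes> x}" for i t
  have A: "A i t \<subseteq> carrier G" for i t by (auto simp: A_def)
  have "(\<Sum>t\<in>U. \<mu> (A i t)) = 1" for i
  proof -
    have "(\<Union>t\<in>U. A i t) = carrier G"
      using f by (fastforce simp: A_def set_mult_def)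
    moreover have "disjoint_family_on (A i) U"
      using U by (auto simp: disjoint_family_on_def A_def subset_iff)
    ultimately show ?thesis using mu_UN[of U "A i"] A U total by simp
  qed
  then have "2 = (\<Sum>i\<in>(UNIV::bool set). \<Sum>t\<in>U. \<mu> (A i t))" by simp
  also have "\<dots> = (\<Sum>(i, t)\<in>UNIV \<times> U. \<mu> (t <#\<^bsub>G\<^esub> A i t))"
    using A U invariant by (auto simp: sum.cartesian_product intro!: sum.cong)
  also have "\<dots> = (\<Sum>p\<in>UNIV \<times> U. \<mu> (snd p <#\<^bsub>G\<^esub> A (fst p) (snd p)))"
    by (simp add: case_prod_beta)
  also have "\<dots> = \<mu> (\<Union>p\<in>UNIV \<times> U. snd p <#\<^bsub>G\<^esub> A (fst p) (snd p))"
  proof (rule mu_UN[symmetric])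
    show "disjoint_family_on (\<lambda>p. snd p <#\<^bsub>G\<^esub> A (fst p) (snd p)) (UNIV \<times> U)"
    proof (unfold disjoint_family_on_def, intro ballI impI equals0I)
      fix p q z assume pq: "p \<in> (UNIV::bool set) \<times> U" "q \<in> UNIV \<times> U" "p \<noteq> q"
        and z: "z \<in> (snd p <#\<^bsub>G\<^esub> A (fst p) (snd p)) \<inter> (snd q <#\<^bsub>G\<^esub> A (fst q) (snd q))"
      then obtain x y where x: "x \<in> A (fst p) (snd p)" "z = snd p \<otimes> x"
        and y: "y \<in> A (fst q) (snd q)" "z = snd q \<otimes> y"
        unfolding l_coset_def by blast
      \<comment> \<open>Both values of \<open>f\<close> are the common point \<open>z\<close>.
        Injectivity of \<open>f\<close> recovers the copy and the point, and cancellation the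
        translating element.\<close>
      then have "f (x, fst p) = f (y, fst q)" "x \<in> carrier G" "y \<in> carrier G" by (auto simp: A_def)
      with inj have "(x, fst p) = (y, fst q)" by (auto dest: inj_onD)
      moreover from this x y pq U have "snd p = snd q"
        by (auto simp: A_def subset_iff)
      ultimately show False using \<open>p \<noteq> q\<close> by (simp add: prod_eq_iff)
    qed
  qed (use U A in \<open>auto simp: l_coset_def subset_iff\<close>)
  also have "\<dots> \<le> 1"
  proof -
    \<comment> \<open>Monotonicity comes from additivity and the nonnegative measure of the
      complement.\<close>
    define X where "X = (\<Union>p\<in>UNIV \<times> U. snd p <#\<^bsub>G\<^esub> A (fst p) (snd p))"
    have X: "X \<subseteq> carrier G" using U A by (auto simp: X_def l_coset_def subset_iff)
    then have "\<mu> (X \<union> (carrier G - X)) = \<mu> X + \<mu> (carrier G - X)" by (intro add) auto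
    moreover have "X \<union> (carrier G - X) = carrier G" using X by blast
    ultimately show ?thesis using nonneg[rule_format, of "carrier G - X"] total by (simp add: X_def)
  qed
  finally show False by simp
qed

theorem theorem2p1:
  fixes G (structure) and \<alpha> \<beta> :: "'a \<Rightarrow> complex"
  assumes "group G" and "amenable G"
    and "\<alpha> \<in> group_algebra G" and "\<alpha> \<noteq> (\<lambda>_. 0)"
    and "\<beta> \<in> ell2 G" and "\<beta> \<noteq> (\<lambda>_. 0)"
    and "convolution G \<alpha> \<beta> = (\<lambda>_. 0)"
  shows "\<exists>\<gamma> \<in> group_algebra G. \<gamma> \<noteq> (\<lambda>_. 0) \<and> convolution G \<alpha> \<gamma> = (\<lambda>_. 0)"
proof (rule ccontr)
  interpret group G by fact
  assume "\<not> ?thesis"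
  then have inj: "\<gamma> = (\<lambda>_. 0)" if "\<gamma> \<in> group_algebra G" "convolution G \<alpha> \<gamma> = (\<lambda>_. 0)" for \<gamma>
    using that by blast
  show False
  proof (rule uniform_expansion[OF assms(3-7) inj])
    fix \<tau> T
    assume expansion: "\<tau> > 0" "finite T" "T \<subseteq> carrier G"
      "\<And>E. finite E \<Longrightarrow> E \<subseteq> carrier G \<Longrightarrow> (1 + \<tau>) * real (card E) \<le> real (card (T <#> E))"
    show False
    proof (rule expansion_doubling[OF expansion])
      fix U
      assume "finite U" "U \<subseteq> carrier G"
        "\<And>E. finite E \<Longrightarrow> E \<subseteq> carrier G \<Longrightarrow> 2 * card E \<le> card (U <#> E)"
      with \<open>amenable G\<close> show False by (rule amenable_not_doubling)
    qed
  qed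
qed

end
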